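(* Let $q$ be a prime power, let $d\ge 2$ be an integer and $k=d-1$. Let $\mathcal{F}$ be a set of $r\ge 2$ linear cellular automata $F_1,\dots,F_r : \mathbb{F}_q^{2k} \to \mathbb{F}_q^k$ defined by linear local rules $f_1,\dots,f_r : \mathbb{F}_q^d \to \mathbb{F}_q$ of diameter $d$, each having nonzero first coefficient and last coefficient equal to $1$. Suppose that for all $i \neq j$ the associated polynomials are coprime, that is, $\gcd(P_{f_i}, P_{f_j}) = 1$. Then the Grassmannian code $\mathcal{C}_{\mathcal{F}}=\{\ker(F_i):1\le i\le r\}$ has minimum distance $$D(\mathcal{C}_{\mathcal{F}}) = 2k.$$
   Context: $\mathbb{F}_q$ is the finite field with $q$ elements. A cellular automaton (CA) of length $n$, diameter $d$ (with $d\le n$, $k=d-1$) and local rule $f:\mathbb{F}_q^d\to\mathbb{F}_q$ is the map $F:\mathbb{F}_q^n \to \mathbb{F}_q^{n-k}$ given by $F(x_0,\dots,x_{n-1})_i = f(x_i,\dots,x_{i+k})$ for $0\le i\le n-k-1$; here $n=2k$. The CA is linear if $f(x_0,\dots,x_k)=a_0x_0+\cdots+a_kx_k$ with $a_i\in\mathbb{F}_q$; the associated polynomial is $P_f(X)=a_0+a_1X+\cdots+a_kX^k$. Standing assumption: $a_0\neq 0$ and $a_k=1$. The distance between subspaces $A,B$ of $\mathbb{F}_q^n$ is $d(A,B)=\dim A+\dim B-2\dim(A\cap B)$. The minimum distance $D(\mathcal{C})$ of a set $\mathcal{C}$ of subspaces is the minimum of $d(U,V)$ over distinct $U,V\in\mathcal{C}$.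 A Grassmannian code is a set of subspaces of $\mathbb{F}_q^n$ all of the same dimension. *)

theory Defs
  imports
    "HOL-Computational_Algebra.Polynomial"
    "Jordan_Normal_Form.VS_Connect"
begin

definition cell_aut :: "nat \<Rightarrow> nat \<Rightarrow> ('a vec \<Rightarrow> 'a) \<Rightarrow> 'a vec \<Rightarrow> 'a vec" where
  "cell_aut n d f x = vec (n - (d - 1)) (\<lambda>i. f (vec d (\<lambda>j. x $ (i + j))))"

(* The vector a lists the coefficients a_0, ..., a_k, where k = d - 1 and d = dim_vec a. *)
definition linear_rule :: "'a::comm_ring_1 vec \<Rightarrow> 'a vec \<Rightarrow> 'a" where
  "linear_rule a x = a \<bullet> x"

definition rule_poly :: "'a::comm_ring_1 vec \<Rightarrow> 'a poly" where
  "rule_poly a = (\<Sum>i<dim_vec a. monom (a $ i) i)"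

definition ca_kernel :: "nat \<Rightarrow> nat \<Rightarrow> ('a::zero vec \<Rightarrow> 'a) \<Rightarrow> 'a vec set" where
  "ca_kernel n d f = {x \<in> carrier_vec n. cell_aut n d f x = 0\<^sub>v (n - (d - 1))}"

definition subspace_dim :: "nat \<Rightarrow> 'a::field vec set \<Rightarrow> nat" where
  "subspace_dim n U =
     vectorspace.dim class_ring ((module_vec TYPE('a) n) \<lparr>carrier := U\<rparr>)"

(* Integer-valued, so that the subtraction is not truncated. *)
definition subspace_dist :: "nat \<Rightarrow> 'a::field vec set \<Rightarrow> 'a vec set \<Rightarrow> int" where
  "subspace_dist n U V =
     int (subspace_dim n U) + int (subspace_dim n V) - 2 * int (subspace_dim n (U \<inter> V))"

definition grassmannian_code :: "nat \<Rightarrow> 'a::field vec set set \<Rightarrow> bool" where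
  "grassmannian_code n C \<longleftrightarrow>
     (\<forall>U\<in>C. subspace class_ring U (module_vec TYPE('a) n)) \<and>
     (\<exists>m. \<forall>U\<in>C. subspace_dim n U = m)"

(* Min is unspecified on infinite sets and on the empty set. Over a finite field there are
   only finitely many subspaces, so only codes with fewer than two elements are affected. *)
definition min_distance :: "nat \<Rightarrow> 'a::{field, finite} vec set set \<Rightarrow> int" where
  "min_distance n C = Min {subspace_dist n U V | U V. U \<in> C \<and> V \<in> C \<and> U \<noteq> V}"

end

theory Submission
  imports Defs
begin

text \<open>
  A state \<open>x\<close> of length \<open>2 * k\<close> is read as the linear functional \<open>p \<mapsto> \<Sum>i. coeff p i * x $ i\<close> on
  polynomials of degree less than \<open>2 * k\<close>. It lies in the kernel of the automaton with polynomial
  \<open>P\<close> iff this functional kills all products \<open>P * u\<close> with \<open>degree u < k\<close>. For coprime \<open>P\<close> and \<open>Q\<close>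
  of degree \<open>k\<close>, such products of \<open>P\<close> and of \<open>Q\<close> span all polynomials of degree less than
  \<open>2 * k\<close>, so distinct kernels meet trivially. As every automaton is surjective, the kernels have
  dimension \<open>k\<close>.
\<close>

subsection \<open>Bezout representations of polynomials\<close>

text \<open>A nonzero element \<open>g\<close> of least degree in the ideal \<open>I\<close>
  generated by \<open>p\<close> and \<open>q\<close> divides every element of \<open>I\<close>,
  since remainders modulo \<open>g\<close> stay in \<open>I\<close>. Hence \<open>g\<close> is a
  common divisor of \<open>p\<close> and \<open>q\<close>, so a unit.\<close>

lemma poly_bezout_coprime:
  fixes p q :: "'a::field poly"
  assumes "coprime p q" "p \<noteq> 0"
  shows "\<exists>u v. u * p + v * q = 1"
proof -
  define I where "I = {u * p + v * q | u v. True}"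
  have "1 * p + 0 * q \<in> I" unfolding I_def by blast
  then have "p \<in> I \<and> p \<noteq> 0" using assms by simp
  then obtain g where g: "g \<in> I" "g \<noteq> 0"
    and min: "\<And>h. h \<in> I \<Longrightarrow> h \<noteq> 0 \<Longrightarrow> degree g \<le> degree h"
    using ex_has_least_nat[of "\<lambda>h. h \<in> I \<and> h \<noteq> 0" p degree] by blast
  obtain s t where st: "g = s * p + t * q" using g(1) unfolding I_def by blast
  have dvd: "g dvd h" if "h \<in> I" for h
  proof -
    obtain u v where uv: "h = u * p + v * q" using \<open>h \<in> I\<close> unfolding I_def by blast
    have "h mod g = h - (h div g) * g" by (simp add: minus_div_mult_eq_mod)
    also have "\<dots> = (u - (h div g) * s) * p + (v - (h div g) * t) * q"
      unfolding uv st by (simp add: algebra_simps)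
    finally have "h mod g \<in> I" unfolding I_def by blast
    then have "h mod g = 0"
      using min degree_mod_less[OF g(2), of h] by fastforce
    then show ?thesis by (simp add: dvd_eq_mod_eq_0)
  qed
  have "0 * p + 1 * q \<in> I" unfolding I_def by blast
  then have "g dvd p" "g dvd q" using dvd \<open>p \<in> I \<and> p \<noteq> 0\<close> by simp_all
  then have "g dvd 1" using assms(1) coprime_common_divisor by blast
  then obtain w where "1 = g * w" by (elim dvdE)
  then have "(w * s) * p + (w * t) * q = 1" unfolding st by (simp add: algebra_simps)
  then show ?thesis by blast
qed

lemma poly_bezout_degree_less:
  fixes p q r :: "'a::field poly"
  assumes "coprime p q" "degree p = k" "degree q = k" "0 < k" "degree r < 2 * k"
  shows "\<exists>u v. r = p * u + q * v \<and> degree u < k \<and> degree v < k"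
proof -
  have nz: "p \<noteq> 0" "q \<noteq> 0" using assms by auto
  obtain u v where uv: "u * p + v * q = 1"
    using poly_bezout_coprime[OF assms(1) nz(1)] by blast
  \<comment> \<open>Reducing \<open>r * u\<close> modulo \<open>q\<close> bounds its degree; the
    discarded multiple of \<open>q\<close> is moved into the cofactor of \<open>q\<close>.\<close>
  define u' where "u' = (r * u) mod q"
  define v' where "v' = r * v + p * ((r * u) div q)"
  have "r = r * (u * p + v * q)" using uv by simp
  also have "\<dots> = p * (r * u) + q * (r * v)" by (simp add: algebra_simps)
  also have "p * (r * u) = p * ((r * u) div q * q + u')"
    unfolding u'_def by simp
  finally have r: "r = p * u' + q * v'" unfolding v'_def by (simp add: algebra_simps)
  have du: "degree u' < k"
    using degree_mod_less[OF nz(2), of "r * u"] assms(3,4) unfolding u'_def by auto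
  have "degree v' < k"
  \<comment> \<open>No reduction of \<open>v'\<close> is needed: \<open>q * v' = r - p * u'\<close>
    has degree below \<open>2 * k\<close>, and \<open>q\<close> already accounts for
    \<open>k\<close> of it.\<close>
  proof (cases "v' = 0")
    case False
    have "degree (p * u') < 2 * k"
      using degree_mult_le[of p u'] du assms(2) by simp
    then have "degree (r - p * u') < 2 * k" using assms(5) by (rule degree_diff_less[rotated])
    moreover have "r - p * u' = q * v'" using r by simp
    ultimately show ?thesis using degree_mult_eq[OF nz(2) False] assms(3) by simp
  qed (use assms in simp)
  then show ?thesis using r du by blast
qed

subsection \<open>Cellular automata with a linear rule\<close>

lemma cell_aut_dim: "dim_vec (cell_aut n d f x) = n - (d - 1)"
  by (simp add: cell_aut_def)

lemma cell_aut_linear_index: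
  assumes "i < n - (d - 1)" "a \<in> carrier_vec d"
  shows "cell_aut n d (linear_rule a) x $ i = (\<Sum>j<d. a $ j * x $ (i + j))"
  using assms by (simp add: cell_aut_def linear_rule_def scalar_prod_def atLeast0LessThan)

lemma coeff_rule_poly:
  "coeff (rule_poly a) i = (if i < dim_vec a then a $ i else 0)"
  by (simp add: rule_poly_def coeff_sum)

lemma degree_rule_poly:
  assumes "dim_vec a = Suc k" "a $ k \<noteq> 0"
  shows "degree (rule_poly a) = k"
proof (rule antisym)
  show "degree (rule_poly a) \<le> k"
    by (rule degree_le) (simp add: coeff_rule_poly assms)
  show "k \<le> degree (rule_poly a)"
    by (rule le_degree) (simp add: coeff_rule_poly assms)
qed

definition vec_functional :: "'a::comm_ring_1 vec \<Rightarrow> 'a poly \<Rightarrow> 'a" where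
  "vec_functional x p = (\<Sum>i<dim_vec x. coeff p i * x $ i)"

lemma vec_functional_add: "vec_functional x (p + q) = vec_functional x p + vec_functional x q"
  by (simp add: vec_functional_def algebra_simps sum.distrib)

lemma vec_functional_sum: "vec_functional x (sum f A) = (\<Sum>i\<in>A. vec_functional x (f i))"
  unfolding vec_functional_def coeff_sum sum_distrib_right by (rule sum.swap)

text \<open>Multiplying by a monomial of degree \<open>i\<close> shifts the coefficients of the rule
  to the window starting at cell \<open>i\<close>, so the functional returns \<open>c\<close> times
  the output of the automaton at \<open>i\<close>.\<close>

lemma vec_functional_rule_poly_mult_monom:
  assumes "i + d \<le> dim_vec x" "a \<in> carrier_vec d"
  shows "vec_functional x (rule_poly a * monom c i) = c * (\<Sum>j<d. a $ j * x $ (i + j))"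
proof -
  have "vec_functional x (rule_poly a * monom c i)
    = (\<Sum>m<dim_vec x. (if m < i then 0 else c * coeff (rule_poly a) (m - i)) * x $ m)"
    by (simp add: vec_functional_def mult.commute[of "rule_poly a"] coeff_monom_mult)
  also have "\<dots> = (\<Sum>m\<in>{i..<i+d}. c * a $ (m - i) * x $ m)"
    using assms by (intro sum.mono_neutral_cong_right) (auto simp: coeff_rule_poly)
  also have "\<dots> = (\<Sum>j<d. c * a $ j * x $ (i + j))"
    by (rule sum.reindex_bij_witness[of _ "\<lambda>j. i + j" "\<lambda>m. m - i"]) auto
  finally show ?thesis by (simp add: sum_distrib_left mult.assoc)
qed

text \<open>The bound \<open>degree u < k\<close> matches the \<open>k\<close> output cells: each
  monomial of \<open>u\<close> contributes a multiple of one output, and all outputs are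
  zero.\<close>

lemma vec_functional_kernel:
  assumes x: "x \<in> ca_kernel (2 * k) (Suc k) (linear_rule a)"
    and a: "a \<in> carrier_vec (Suc k)" and u: "degree u < k"
  shows "vec_functional x (rule_poly a * u) = 0"
proof -
  have dx: "dim_vec x = 2 * k" and
    ker: "cell_aut (2 * k) (Suc k) (linear_rule a) x = 0\<^sub>v (2 * k - (Suc k - 1))"
    using x unfolding ca_kernel_def by auto
  have "rule_poly a * u = (\<Sum>i\<le>degree u. rule_poly a * monom (coeff u i) i)"
    by (simp add: sum_distrib_left[symmetric] poly_as_sum_of_monoms)
  moreover have "vec_functional x (rule_poly a * monom (coeff u i) i) = 0" if "i \<le> degree u" for i
  proof -
    have "(\<Sum>j<Suc k. a $ j * x $ (i + j)) = 0"
      using cell_aut_linear_index[of i "2 * k" "Suc k" a x] a that u by (simp add: ker)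
    then show ?thesis
      using vec_functional_rule_poly_mult_monom[of i "Suc k" x a] that u dx a by simp
  qed
  ultimately show ?thesis by (simp add: vec_functional_sum)
qed

text \<open>The functional of \<open>x\<close> at \<open>monom 1 i\<close> is the entry
  \<open>x $ i\<close>. For \<open>i < 2 * k\<close> this monomial splits into a multiple of each
  rule polynomial with cofactors of degree below \<open>k\<close>, and both parts are
  killed.\<close>

lemma ca_kernel_Int_coprime:
  fixes a b :: "'a::field vec"
  assumes a: "a \<in> carrier_vec (Suc k)" "a $ k \<noteq> 0"
    and b: "b \<in> carrier_vec (Suc k)" "b $ k \<noteq> 0"
    and cop: "coprime (rule_poly a) (rule_poly b)"
    and x: "x \<in> ca_kernel (2 * k) (Suc k) (linear_rule a)"
      "x \<in> ca_kernel (2 * k) (Suc k) (linear_rule b)"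
  shows "x = 0\<^sub>v (2 * k)"
proof (rule eq_vecI)
  have dx: "dim_vec x = 2 * k" using x(1) unfolding ca_kernel_def by auto
  then show "dim_vec x = dim_vec (0\<^sub>v (2 * k))" by simp
  fix i assume "i < dim_vec (0\<^sub>v (2 * k) :: 'a vec)"
  then have i: "i < 2 * k" by simp
  have "\<exists>u v. monom 1 i = rule_poly a * u + rule_poly b * v \<and> degree u < k \<and> degree v < k"
    using a b i by (intro poly_bezout_degree_less[OF cop])
      (auto simp: degree_rule_poly degree_monom_eq)
  then have "vec_functional x (monom 1 i) = 0"
    using vec_functional_kernel[OF x(1) a(1)] vec_functional_kernel[OF x(2) b(1)]
    by (auto simp: vec_functional_add)
  moreover have "vec_functional x (monom 1 i) = (\<Sum>m<2 * k. if m = i then x $ m else 0)"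
    unfolding vec_functional_def dx by (rule sum.cong) auto
  ultimately show "x $ i = 0\<^sub>v (2 * k) $ i" using i by simp
qed

subsection \<open>Dimension of the kernels\<close>

text \<open>The equations are solved from left to right: equation \<open>m\<close> fixes the value
  at \<open>m + k\<close> after division by \<open>c k\<close>, and no earlier equation reads that
  position.\<close>

lemma ex_linear_recurrence:
  fixes c y :: "nat \<Rightarrow> 'a::field"
  assumes "c k \<noteq> 0"
  shows "\<exists>x. \<forall>i<m. (\<Sum>j<Suc k. c j * x (i + j)) = y i"
proof (induction m)
  case (Suc m)
  then obtain x where x: "\<And>i. i < m \<Longrightarrow> (\<Sum>j<Suc k. c j * x (i + j)) = y i" by blast
  define x' where "x' = x(m + k := (y m - (\<Sum>j<k. c j * x (m + j))) / c k)"
  have "(\<Sum>j<Suc k. c j * x' (i + j)) = y i" if "i < Suc m" for i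
  proof (cases "i = m")
    case True
    have "(\<Sum>j<k. c j * x' (m + j)) = (\<Sum>j<k. c j * x (m + j))"
      by (rule sum.cong) (auto simp: x'_def)
    then show ?thesis using True assms by (simp add: x'_def)
  next
    case False
    then have "(\<Sum>j<Suc k. c j * x' (i + j)) = (\<Sum>j<Suc k. c j * x (i + j))"
      using that by (intro sum.cong) (auto simp: x'_def)
    then show ?thesis using x False that by simp
  qed
  then show ?case by blast
qed simp

lemma cell_aut_linear_map:
  fixes a :: "'a::field vec"
  assumes "a \<in> carrier_vec d"
  shows "linear_map class_ring (module_vec TYPE('a) n) (module_vec TYPE('a) (n - (d - 1)))
    (cell_aut n d (linear_rule a))"
proof -
  interpret V: vec_space "TYPE('a)" n .
  interpret W: vec_space "TYPE('a)" "n - (d - 1)" .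
  have ind: "i + j < n" if "i < n - (d - 1)" "j < d" for i j using that by linarith
  have "cell_aut n d (linear_rule a) (x + y)
      = cell_aut n d (linear_rule a) x + cell_aut n d (linear_rule a) y"
    if "x \<in> carrier_vec n" "y \<in> carrier_vec n" for x y
  proof (rule eq_vecI)
    fix i assume "i < dim_vec (cell_aut n d (linear_rule a) x + cell_aut n d (linear_rule a) y)"
    then have i: "i < n - (d - 1)" by (simp add: cell_aut_def)
    have "(\<Sum>j<d. a $ j * (x + y) $ (i + j))
        = (\<Sum>j<d. a $ j * x $ (i + j) + a $ j * y $ (i + j))"
      using ind[OF i] that by (intro sum.cong) (simp_all add: distrib_left)
    then show "cell_aut n d (linear_rule a) (x + y) $ i
        = (cell_aut n d (linear_rule a) x + cell_aut n d (linear_rule a) y) $ i"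
      using i by (simp add: cell_aut_linear_index[OF i assms] sum.distrib cell_aut_dim)
  qed (simp add: cell_aut_dim)
  moreover have "cell_aut n d (linear_rule a) (c \<cdot>\<^sub>v x) = c \<cdot>\<^sub>v cell_aut n d (linear_rule a) x"
    if "x \<in> carrier_vec n" for x c
  proof (rule eq_vecI)
    fix i assume "i < dim_vec (c \<cdot>\<^sub>v cell_aut n d (linear_rule a) x)"
    then have i: "i < n - (d - 1)" by (simp add: cell_aut_def)
    have "(\<Sum>j<d. a $ j * (c \<cdot>\<^sub>v x) $ (i + j)) = (\<Sum>j<d. c * (a $ j * x $ (i + j)))"
      using ind[OF i] that by (intro sum.cong) (simp_all add: mult.left_commute)
    then show "cell_aut n d (linear_rule a) (c \<cdot>\<^sub>v x) $ i
        = (c \<cdot>\<^sub>v cell_aut n d (linear_rule a) x) $ i"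
      using i by (simp add: cell_aut_linear_index[OF i assms] sum_distrib_left cell_aut_dim)
  qed (simp add: cell_aut_dim)
  ultimately show ?thesis
    by unfold_locales
      (auto simp: LinearCombinations.module_hom_def module_vec_simps cell_aut_def)
qed

text \<open>A preimage is a solution of the recurrence with right-hand side \<open>y\<close>, cut
  off after \<open>n\<close> entries; the output cells \<open>i < n - k\<close> read only positions
  below \<open>n\<close>.\<close>

lemma cell_aut_linear_surj:
  fixes a :: "'a::field vec"
  assumes a: "a \<in> carrier_vec (Suc k)" "a $ k \<noteq> 0" and "k \<le> n"
  shows "cell_aut n (Suc k) (linear_rule a) ` carrier_vec n = carrier_vec (n - k)"
proof (intro equalityI subsetI)
  fix y :: "'a vec" assume y: "y \<in> carrier_vec (n - k)"
  obtain x where x: "\<And>i. i < n - k \<Longrightarrow> (\<Sum>j<Suc k. a $ j * x (i + j)) = y $ i"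
    using ex_linear_recurrence[of "\<lambda>j. a $ j" k "n - k" "\<lambda>i. y $ i"] a(2) by blast
  have "cell_aut n (Suc k) (linear_rule a) (vec n x) = y"
  proof (rule eq_vecI)
    fix i assume "i < dim_vec y"
    then have i: "i < n - k" using y by simp
    have "cell_aut n (Suc k) (linear_rule a) (vec n x) $ i
      = (\<Sum>j<Suc k. a $ j * vec n x $ (i + j))"
      using i a by (intro cell_aut_linear_index) auto
    also have "\<dots> = (\<Sum>j<Suc k. a $ j * x (i + j))"
      using i by (intro sum.cong) auto
    finally show "cell_aut n (Suc k) (linear_rule a) (vec n x) $ i = y $ i" using x i by simp
  qed (use y in \<open>simp add: cell_aut_def\<close>)
  then show "y \<in> cell_aut n (Suc k) (linear_rule a) ` carrier_vec n"
    using vec_carrier by blast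
qed (auto simp: cell_aut_def)

text \<open>Both facts view the kernel as that of a linear map. By surjectivity the rank is
  \<open>n - k\<close>, so rank-nullity leaves dimension \<open>k\<close>.\<close>

lemma
  fixes a :: "'a::field vec"
  assumes a: "a \<in> carrier_vec (Suc k)"
  shows ca_kernel_subspace:
      "VectorSpace.subspace class_ring (ca_kernel n (Suc k) (linear_rule a)) (module_vec TYPE('a) n)"
    and subspace_dim_ca_kernel:
      "a $ k \<noteq> 0 \<Longrightarrow> k \<le> n \<Longrightarrow> subspace_dim n (ca_kernel n (Suc k) (linear_rule a)) = k"
proof -
  interpret V: vec_space "TYPE('a)" n .
  interpret W: vec_space "TYPE('a)" "n - (Suc k - 1)" .
  interpret F: linear_map class_ring "module_vec TYPE('a) n"
    "module_vec TYPE('a) (n - (Suc k - 1))" "cell_aut n (Suc k) (linear_rule a)"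
    by (rule cell_aut_linear_map[OF a])
  have ker: "F.ker = ca_kernel n (Suc k) (linear_rule a)"
    unfolding F.ker_def ca_kernel_def module_vec_simps ..
  show "VectorSpace.subspace class_ring (ca_kernel n (Suc k) (linear_rule a)) (module_vec TYPE('a) n)"
    using F.kerT_is_subspace unfolding ker .
  assume "a $ k \<noteq> 0" "k \<le> n"
  then have im: "F.im = carrier_vec (n - k)"
    using cell_aut_linear_surj[OF a] by (simp add: F.im_def module_vec_simps)
  \<comment> \<open>Rank-nullity measures the image as a module with restricted carrier; here the
    restriction is to the whole space.\<close>
  have "module_vec TYPE('a) (n - k)\<lparr>carrier := carrier_vec (n - k)\<rparr> = module_vec TYPE('a) (n - k)"
    by (simp add: module_vec_def)
  then show "subspace_dim n (ca_kernel n (Suc k) (linear_rule a)) = k"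
    using F.rank_nullity[OF V.fin_dim, unfolded ker im V.dim_is_n] W.dim_is_n \<open>k \<le> n\<close>
    by (simp add: subspace_dim_def)
qed

text \<open>The zero space is the kernel of the identity map, which is injective.\<close>

lemma subspace_dim_zero: "subspace_dim n {0\<^sub>v n :: 'a::field vec} = 0"
proof -
  interpret V: vec_space "TYPE('a)" n .
  interpret F: linear_map class_ring "module_vec TYPE('a) n" "module_vec TYPE('a) n" "\<lambda>x. x"
    by unfold_locales (auto simp: LinearCombinations.module_hom_def)
  have "F.ker = {0\<^sub>v n}" by (auto simp: F.ker_def module_vec_simps)
  then show ?thesis using F.inj_imp_dim_ker0 by (simp add: subspace_dim_def inj_on_def)
qed

theorem lemma4:
  fixes a :: "nat \<Rightarrow> 'a::{field, finite} vec"
    and d k r :: nat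
    and C :: "'a vec set set"
  assumes "d \<ge> 2" and "k = d - 1" and "r \<ge> 2"
    and "\<And>i. i \<in> {1..r} \<Longrightarrow> a i \<in> carrier_vec d"
    and "\<And>i. i \<in> {1..r} \<Longrightarrow> a i $ 0 \<noteq> 0"
    and "\<And>i. i \<in> {1..r} \<Longrightarrow> a i $ k = 1"
    and "\<And>i j. i \<in> {1..r} \<Longrightarrow> j \<in> {1..r} \<Longrightarrow> i \<noteq> j \<Longrightarrow>
           coprime (rule_poly (a i)) (rule_poly (a j))"
    and "C = {ca_kernel (2 * k) d (linear_rule (a i)) | i. i \<in> {1..r}}"
  shows "grassmannian_code (2 * k) C \<and> min_distance (2 * k) C = 2 * int k"
proof -
  define K where "K i = ca_kernel (2 * k) d (linear_rule (a i))" for i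
  have d: "d = Suc k" and k: "0 < k" using assms(1,2) by auto
  have C: "C = K ` {1..r}" using assms(8) by (auto simp: K_def)
  have a: "a i \<in> carrier_vec (Suc k)" "a i $ k \<noteq> 0" if "i \<in> {1..r}" for i
    using assms(4,6) that d by auto
  have dim: "subspace_dim (2 * k) (K i) = k" if "i \<in> {1..r}" for i
    using subspace_dim_ca_kernel[OF a(1)[OF that] a(2)[OF that]] unfolding K_def d by simp
  have sub: "VectorSpace.subspace class_ring (K i) (module_vec TYPE('a) (2 * k))" if "i \<in> {1..r}" for i
    using ca_kernel_subspace[OF a(1)[OF that]] unfolding K_def d .
  have zero: "0\<^sub>v (2 * k) \<in> K i" if "i \<in> {1..r}" for i
    using a(1)[OF that] unfolding K_def d ca_kernel_def
    by (auto simp: cell_aut_def linear_rule_def scalar_prod_def)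
  have Int: "K i \<inter> K j = {0\<^sub>v (2 * k)}" if "i \<in> {1..r}" "j \<in> {1..r}" "i \<noteq> j" for i j
    using ca_kernel_Int_coprime[OF a[OF that(1)] a[OF that(2)] assms(7)[OF that]]
      zero[OF that(1)] zero[OF that(2)] unfolding K_def d by blast
  have dist: "subspace_dist (2 * k) (K i) (K j) = 2 * int k"
    if "i \<in> {1..r}" "j \<in> {1..r}" "i \<noteq> j" for i j
    using dim that by (simp add: subspace_dist_def Int subspace_dim_zero)
  \<comment> \<open>If these kernels were equal, each would be their intersection, the zero space,
    contradicting dimension \<open>k > 0\<close>. So the set of distances below is nonempty.\<close>
  have ne: "K 1 \<noteq> K 2"
    using Int[of 1 2] dim[of 1] k assms(3) subspace_dim_zero[of "2 * k", where ?'a = 'a] by auto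
  have "{subspace_dist (2 * k) U V | U V. U \<in> C \<and> V \<in> C \<and> U \<noteq> V} = {2 * int k}" (is "?D = _")
  proof
    show "?D \<subseteq> {2 * int k}" 
    proof
      fix e assume "e \<in> ?D"
      then obtain i j where ij: "i \<in> {1..r}" "j \<in> {1..r}" "K i \<noteq> K j"
        and e: "e = subspace_dist (2 * k) (K i) (K j)" unfolding C by blast
      \<comment> \<open>Distinct kernels come from distinct indices, which is what
        \<open>dist\<close> requires.\<close>
      then show "e \<in> {2 * int k}" using dist[of i j] by auto
    qed
    have "K 1 \<in> C" "K 2 \<in> C" using assms(3) by (auto simp: C)
    moreover have "2 * int k = subspace_dist (2 * k) (K 1) (K 2)" using dist assms(3) by simp
    ultimately show "{2 * int k} \<subseteq> ?D" using ne by blast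
  qed
  then have "min_distance (2 * k) C = 2 * int k" unfolding min_distance_def by simp
  moreover have "grassmannian_code (2 * k) C"
    unfolding grassmannian_code_def C using sub dim by auto
  ultimately show ?thesis by simp
qed

end
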